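(* Let $p$ be a prime number and let $D$ be the finite abelian group $$D=\mathbb Z/p^7\oplus\mathbb Z/p^6\oplus\mathbb Z/p^4\oplus\mathbb Z/p^3\oplus\mathbb Z/p$$ with corresponding generators $x_1,x_2,x_3,x_4,x_5$ of order $p^7,p^6,p^4,p^3,p$, respectively. For $\lambda\in\{0,\ldots,p-1\}$ let $C_\lambda$ be the subgroup of $D$ generated by $$u_1=p^4x_1+px_4+x_5,\qquad u_2=p^3x_2+p^2x_3+x_5,\qquad u_3=p^3x_3+p^2\lambda x_4.$$ Then the subgroup embeddings $(C_\lambda\subseteq D)$, $\lambda\in\{0,\ldots,p-1\}$, are indecomposable and pairwise nonisomorphic objects in $\mathcal S_3(\mathbb Z/p^7)$.
   Context: The category $\mathcal S_3(\mathbb Z/p^7)$ has as objects all pairs $(A\subseteq B)$ where $B$ is a finite abelian $p^7$-bounded group (i.e. $p^7B=0$) and $A$ is a subgroup of $B$ with $p^3A=0$. A morphism $(A\subseteq B)\to(A'\subseteq B')$ is a group homomorphism $f\colon B\to B'$ with $f(A)\subseteq A'$. *)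

theory Defs
  imports "HOL-Algebra.Algebra" "HOL-Computational_Algebra.Primes"
begin

text \<open>
  Abelian groups are written multiplicatively, as in HOL-Algebra: the multiple \<open>k x\<close>
  is \<open>x [^] k\<close>, and \<open>\<times>\<times>\<close> is the direct sum.  The predicate \<open>S_obj p m n A B\<close> says that
  \<open>(A \<subseteq> B)\<close> is an object of the category \<open>\<S>\<^sub>m(\<int>/p\<^sup>n)\<close>.
\<close>

definition S_obj :: "nat \<Rightarrow> nat \<Rightarrow> nat \<Rightarrow> 'a set \<Rightarrow> 'a monoid \<Rightarrow> bool" where
  "S_obj p m n A B \<longleftrightarrow>
     comm_group B \<and> finite (carrier B) \<and> (\<forall>b\<in>carrier B. b [^]\<^bsub>B\<^esub> (p ^ n) = \<one>\<^bsub>B\<^esub>) \<and>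
     subgroup A B \<and> (\<forall>a\<in>A. a [^]\<^bsub>B\<^esub> (p ^ m) = \<one>\<^bsub>B\<^esub>)"

definition S_mor :: "'a set \<Rightarrow> 'a monoid \<Rightarrow> 'b set \<Rightarrow> 'b monoid \<Rightarrow> ('a \<Rightarrow> 'b) set" where
  "S_mor A B A' B' = {f \<in> hom B B'. f ` A \<subseteq> A'}"

text \<open>
  The inverse has to be a morphism as well: a group isomorphism \<open>B \<rightarrow> B'\<close> that only
  maps \<open>A\<close> into \<open>A'\<close> is not an isomorphism of pairs.
\<close>

definition S_isomorphic :: "'a set \<Rightarrow> 'a monoid \<Rightarrow> 'b set \<Rightarrow> 'b monoid \<Rightarrow> bool" where
  "S_isomorphic A B A' B' \<longleftrightarrow>
     (\<exists>f \<in> S_mor A B A' B'. \<exists>g \<in> S_mor A' B' A B.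
        (\<forall>x\<in>carrier B. g (f x) = x) \<and> (\<forall>y\<in>carrier B'. f (g y) = y))"

text \<open>
  An object is indecomposable if it is nonzero and not isomorphic to a direct sum
  \<open>(A1 \<times> A2 \<subseteq> B1 \<times> B2)\<close> of two nonzero objects.  The two type arguments are the types of
  the elements of \<open>B1\<close> and \<open>B2\<close>; they only serve to express the quantification over all
  summands, and are meant to be free type variables in theorems.
\<close>

definition S_indecomposable ::
    "'b itself \<Rightarrow> 'c itself \<Rightarrow> nat \<Rightarrow> nat \<Rightarrow> nat \<Rightarrow> 'a set \<Rightarrow> 'a monoid \<Rightarrow> bool" where
  "S_indecomposable tb tc p m n A B \<longleftrightarrow>
     S_obj p m n A B \<and> \<not> trivial_group B \<and>
     (\<forall>(A1 :: 'b set) B1 (A2 :: 'c set) B2.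
        S_obj p m n A1 B1 \<longrightarrow> S_obj p m n A2 B2 \<longrightarrow>
        S_isomorphic A B (A1 \<times> A2) (B1 \<times>\<times> B2) \<longrightarrow>
        trivial_group B1 \<or> trivial_group B2)"

type_synonym elem5 = "int \<times> int \<times> int \<times> int \<times> int"

definition grp_D :: "nat \<Rightarrow> elem5 monoid" where
  "grp_D p =
     integer_mod_group (p ^ 7) \<times>\<times> integer_mod_group (p ^ 6) \<times>\<times> integer_mod_group (p ^ 4) \<times>\<times>
     integer_mod_group (p ^ 3) \<times>\<times> integer_mod_group p"

definition x1 :: elem5 where "x1 = (1, 0, 0, 0, 0)"
definition x2 :: elem5 where "x2 = (0, 1, 0, 0, 0)"
definition x3 :: elem5 where "x3 = (0, 0, 1, 0, 0)"
definition x4 :: elem5 where "x4 = (0, 0, 0, 1, 0)"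
definition x5 :: elem5 where "x5 = (0, 0, 0, 0, 1)"

definition u1 :: "nat \<Rightarrow> elem5" where
  "u1 p = (x1 [^]\<^bsub>grp_D p\<^esub> (p ^ 4)) \<otimes>\<^bsub>grp_D p\<^esub> (x4 [^]\<^bsub>grp_D p\<^esub> p) \<otimes>\<^bsub>grp_D p\<^esub> x5"

definition u2 :: "nat \<Rightarrow> elem5" where
  "u2 p = (x2 [^]\<^bsub>grp_D p\<^esub> (p ^ 3)) \<otimes>\<^bsub>grp_D p\<^esub> (x3 [^]\<^bsub>grp_D p\<^esub> (p ^ 2)) \<otimes>\<^bsub>grp_D p\<^esub> x5"

definition u3 :: "nat \<Rightarrow> nat \<Rightarrow> elem5" where
  "u3 p l = (x3 [^]\<^bsub>grp_D p\<^esub> (p ^ 3)) \<otimes>\<^bsub>grp_D p\<^esub> (x4 [^]\<^bsub>grp_D p\<^esub> (p ^ 2 * l))"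

definition sub_C :: "nat \<Rightarrow> nat \<Rightarrow> elem5 set" where
  "sub_C p l = generate (grp_D p) {u1 p, u2 p, u3 p l}"

end

theory Submission
  imports Defs
begin

text \<open>
  A homomorphism \<open>f\<close> from \<open>D\<close> to itself is given by an integer matrix \<open>M\<close>, with columns the
  coordinates of \<open>f x\<^sub>1, \<dots>, f x\<^sub>5\<close>. The orders \<open>p\<^sup>7, p\<^sup>6, p\<^sup>4, p\<^sup>3, p\<close> of the generators are distinct
  and decreasing, so \<open>M\<close> is lower triangular modulo \<open>p\<close>, with known powers of \<open>p\<close> dividing the
  entries above the diagonal (\<open>hom_imp_matrix\<close>). Hence composition multiplies diagonals
  modulo \<open>p\<close>, and every property needed below can be read off the diagonal.

  If \<open>f\<close> maps \<open>C\<^sub>l\<close> into \<open>C\<^sub>m\<close>, then comparing the coordinates of \<open>f u\<^sub>i\<close> with those of a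
  combination of the generators of \<open>C\<^sub>m\<close> ties the diagonal entries together
  (\<open>C_morphism_congruences\<close>): the generator \<open>u\<^sub>1\<close> involves \<open>x\<^sub>1, x\<^sub>4, x\<^sub>5\<close> and forces
  \<open>M\<^sub>1\<^sub>1 \<equiv> M\<^sub>4\<^sub>4 \<equiv> M\<^sub>5\<^sub>5\<close>, the generator \<open>u\<^sub>2\<close> involves \<open>x\<^sub>2, x\<^sub>3, x\<^sub>5\<close> and forces
  \<open>M\<^sub>2\<^sub>2 \<equiv> M\<^sub>3\<^sub>3 \<equiv> M\<^sub>5\<^sub>5\<close>. So the diagonal is a constant \<open>a\<close> modulo \<open>p\<close>. Finally \<open>u\<^sub>3\<close>,
  which pairs \<open>x\<^sub>3\<close> with \<open>l x\<^sub>4\<close>, gives \<open>a l \<equiv> a m\<close>.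

  Both claims follow. For an isomorphism \<open>a\<close> is a unit modulo \<open>p\<close>, so \<open>l \<equiv> m\<close>. For a
  decomposition, let \<open>e\<close> and \<open>e'\<close> be the two complementary idempotents. Then
  \<open>a\<^sup>2 \<equiv> a\<close>, so one of \<open>e, e'\<close> has diagonal \<open>0\<close> modulo \<open>p\<close>. It is then nilpotent modulo \<open>p\<close>;
  an idempotent with this property vanishes (\<open>nilpotent_idempotent_trivial\<close>), and so does
  the corresponding summand.
\<close>

section \<open>Coordinates on the group D\<close>

text \<open>
  The order of \<open>x\<^sub>i\<close> is \<open>p\<close> to the power \<open>expo i\<close>.
\<close>

definition expo :: "nat \<Rightarrow> nat" where
  "expo i = [7, 6, 4, 3, 1] ! (i - 1)"

text \<open>
  The projection of \<open>\<int>\<^sup>5\<close> onto \<open>D\<close>. Integer vectors are functions on \<open>nat\<close> of which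
  only the values at \<open>1, \<dots>, 5\<close> are used, so that \<open>v i\<close> is the coefficient of \<open>x\<^sub>i\<close>.
\<close>

definition red :: "nat \<Rightarrow> (nat \<Rightarrow> int) \<Rightarrow> elem5" where
  "red p v = (v 1 mod int p ^ 7, v 2 mod int p ^ 6, v 3 mod int p ^ 4, v 4 mod int p ^ 3, v 5 mod int p)"

definition mat_vec :: "(nat \<Rightarrow> nat \<Rightarrow> int) \<Rightarrow> (nat \<Rightarrow> int) \<Rightarrow> nat \<Rightarrow> int" where
  "mat_vec M v i = (\<Sum>j = 1..5. M i j * v j)"

text \<open>
  A lift of \<open>a u\<^sub>1 + b u\<^sub>2 + c u\<^sub>3\<close> to \<open>\<int>\<^sup>5\<close>.
\<close>

definition C_vec :: "nat \<Rightarrow> nat \<Rightarrow> int \<Rightarrow> int \<Rightarrow> int \<Rightarrow> nat \<Rightarrow> int" where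
  "C_vec p l a b c i =
     [int p ^ 4 * a, int p ^ 3 * b, int p ^ 2 * b + int p ^ 3 * c,
      int p * a + int p ^ 2 * int l * c, a + b] ! (i - 1)"

lemma index_cases: "(\<forall>i\<in>{1..5::nat}. P i) \<longleftrightarrow> P 1 \<and> P 2 \<and> P 3 \<and> P 4 \<and> P 5"
proof -
  have "{1..5::nat} = {1, 2, 3, 4, 5}" by auto
  then show ?thesis by simp
qed

lemma sum_1_5: "(\<Sum>j = 1..5::nat. f j) = f 1 + f 2 + f 3 + f 4 + (f 5 :: int)"
proof -
  have "{1..5::nat} = {1, 2, 3, 4, 5}" by auto
  then show ?thesis by simp
qed

lemma expo_simps [simp]: "expo (Suc 0) = 7" "expo 1 = 7" "expo 2 = 6" "expo 3 = 4" "expo 4 = 3" "expo 5 = 1"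
  by (simp_all add: expo_def)

lemma C_vec_simps [simp]:
  "C_vec p l a b c (Suc 0) = int p ^ 4 * a"
  "C_vec p l a b c 1 = int p ^ 4 * a"
  "C_vec p l a b c 2 = int p ^ 3 * b"
  "C_vec p l a b c 3 = int p ^ 2 * b + int p ^ 3 * c"
  "C_vec p l a b c 4 = int p * a + int p ^ 2 * int l * c"
  "C_vec p l a b c 5 = a + b"
  by (simp_all add: C_vec_def)

lemma red_eq_iff: "red p v = red p w \<longleftrightarrow> (\<forall>i\<in>{1..5}. int p ^ expo i dvd v i - w i)"
  unfolding index_cases by (simp add: red_def mod_eq_dvd_iff)

lemmas red_eq_coords = red_eq_iff[unfolded index_cases]

lemma group_D: "group (grp_D p)"
  unfolding grp_D_def by (intro DirProd_group group_integer_mod_group)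

lemma comm_group_D: "comm_group (grp_D p)"
  unfolding grp_D_def
  by (intro group.group_comm_groupI DirProd_group group_integer_mod_group)
     (auto simp: DirProd_def mult_integer_mod_group add.commute)

lemma carrier_D: "0 < p \<Longrightarrow> carrier (grp_D p) = range (red p)"
proof
  assume "0 < p"
  show "carrier (grp_D p) \<subseteq> range (red p)"
  proof
    fix x assume x: "x \<in> carrier (grp_D p)"
    obtain a b c d e where abcde: "x = (a, b, c, d, e)" by (metis prod.exhaust)
    have "x = red p (\<lambda>i. [a, b, c, d, e] ! (i - 1))"
      using x \<open>0 < p\<close>
      by (auto simp: abcde red_def grp_D_def carrier_integer_mod_group)
    then show "x \<in> range (red p)" by blast
  qed
  show "range (red p) \<subseteq> carrier (grp_D p)"
    using \<open>0 < p\<close> by (auto simp: red_def grp_D_def carrier_integer_mod_group)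
qed

lemma red_in_D [simp]: "0 < p \<Longrightarrow> red p v \<in> carrier (grp_D p)"
  by (simp add: carrier_D)

lemma red_mult: "red p v \<otimes>\<^bsub>grp_D p\<^esub> red p w = red p (\<lambda>i. v i + w i)"
  by (simp add: red_def grp_D_def mult_integer_mod_group mod_simps)

lemma one_D: "\<one>\<^bsub>grp_D p\<^esub> = red p (\<lambda>i. 0)"
  by (simp add: red_def grp_D_def)

lemma red_pow: "red p v [^]\<^bsub>grp_D p\<^esub> (n::nat) = red p (\<lambda>i. int n * v i)"
proof (induction n)
  case 0
  then show ?case by (simp add: one_D)
next
  case (Suc n)
  then show ?case by (simp add: red_mult algebra_simps)
qed

lemma red_inv:
  assumes "0 < p"
  shows "inv\<^bsub>grp_D p\<^esub> (red p v) = red p (\<lambda>i. - v i)"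
  by (rule group.inv_equality[OF group_D]) (simp_all add: assms red_mult one_D)

lemma finite_D: "0 < p \<Longrightarrow> finite (carrier (grp_D p))"
  by (simp add: grp_D_def carrier_integer_mod_group)

lemma exponent_D:
  assumes "0 < p" "x \<in> carrier (grp_D p)"
  shows "x [^]\<^bsub>grp_D p\<^esub> (p ^ 7) = \<one>\<^bsub>grp_D p\<^esub>"
proof -
  obtain v where "x = red p v" using assms carrier_D by blast
  then show ?thesis
    by (simp add: red_pow one_D red_eq_coords le_imp_power_dvd)
qed

section \<open>The subgroups C\<close>

lemma generators_red:
  assumes "1 < p"
  shows "u1 p = red p (C_vec p l 1 0 0)" "u2 p = red p (C_vec p l 0 1 0)"
    "u3 p l = red p (C_vec p l 0 0 1)"
proof -
  have unit: "x1 = red p (\<lambda>i. of_bool (i = 1))" "x2 = red p (\<lambda>i. of_bool (i = 2))"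
    "x3 = red p (\<lambda>i. of_bool (i = 3))" "x4 = red p (\<lambda>i. of_bool (i = 4))"
    "x5 = red p (\<lambda>i. of_bool (i = 5))"
    using assms by (simp_all add: x1_def x2_def x3_def x4_def x5_def red_def)
  show "u1 p = red p (C_vec p l 1 0 0)" "u2 p = red p (C_vec p l 0 1 0)"
    "u3 p l = red p (C_vec p l 0 0 1)"
    unfolding u1_def u2_def u3_def unit red_pow red_mult red_eq_coords
    by simp_all
qed

lemma sub_C_subset:
  assumes "1 < p"
  shows "sub_C p l \<subseteq> {red p (C_vec p l a b c) | a b c. True}" (is "_ \<subseteq> ?H")
proof -
  have closed: "red p (C_vec p l a b c) \<otimes>\<^bsub>grp_D p\<^esub> red p (C_vec p l a' b' c')
      = red p (C_vec p l (a + a') (b + b') (c + c'))" for a b c a' b' c'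
    unfolding red_mult red_eq_coords by (simp add: algebra_simps)
  have neg: "inv\<^bsub>grp_D p\<^esub> (red p (C_vec p l a b c)) = red p (C_vec p l (- a) (- b) (- c))" for a b c
    using assms by (subst red_inv, simp) (simp add: red_eq_coords del: One_nat_def)
  have "subgroup ?H (grp_D p)"
  proof (rule group.subgroupI[OF group_D])
    show "?H \<subseteq> carrier (grp_D p)" using assms by auto
    show "?H \<noteq> {}" by blast
    show "inv\<^bsub>grp_D p\<^esub> x \<in> ?H" if "x \<in> ?H" for x using that neg by blast
    show "x \<otimes>\<^bsub>grp_D p\<^esub> y \<in> ?H" if "x \<in> ?H" "y \<in> ?H" for x y using that closed by blast
  qed
  then show ?thesis
    unfolding sub_C_def generators_red(1,2)[OF assms, of l] generators_red(3)[OF assms]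
    by (intro group.generate_subgroup_incl[OF group_D]) auto
qed

lemma generators_in_C:
  assumes "1 < p"
  shows "red p (C_vec p l 1 0 0) \<in> sub_C p l" "red p (C_vec p l 0 1 0) \<in> sub_C p l"
    "red p (C_vec p l 0 0 1) \<in> sub_C p l"
  unfolding generators_red[OF assms, symmetric] sub_C_def by (auto intro: generate.incl)

lemma S_obj_C:
  assumes "1 < p"
  shows "S_obj p 3 7 (sub_C p l) (grp_D p)"
proof -
  have "subgroup (sub_C p l) (grp_D p)"
    unfolding sub_C_def generators_red(1,2)[OF assms, of l] generators_red(3)[OF assms]
    using assms by (intro group.generate_is_subgroup[OF group_D]) auto
  moreover have "x [^]\<^bsub>grp_D p\<^esub> (p ^ 3) = \<one>\<^bsub>grp_D p\<^esub>" if C: "x \<in> sub_C p l" for x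
  proof -
    obtain a b c where x: "x = red p (C_vec p l a b c)"
      using sub_C_subset[OF assms, of l] C by blast
    show ?thesis
      unfolding x red_pow one_D red_eq_coords
      by (auto simp: distrib_left mult.assoc[symmetric] power_add[symmetric]
          intro!: dvd_add dvd_mult2 le_imp_power_dvd simp flip: power_Suc power_Suc2)
  qed
  ultimately show ?thesis
    using assms comm_group_D finite_D exponent_D by (auto simp: S_obj_def)
qed

section \<open>Endomorphisms of D as integer matrices\<close>

text \<open>
  The divisibility condition says that \<open>f x\<^sub>j\<close> is annihilated by the order of \<open>x\<^sub>j\<close>.
\<close>

lemma hom_imp_matrix:
  assumes "0 < p" "f \<in> hom (grp_D p) (grp_D p)"
  obtains M where "\<And>v. f (red p v) = red p (mat_vec M v)"
    "\<And>i j. i \<in> {1..5} \<Longrightarrow> j \<in> {1..5} \<Longrightarrow> int p ^ expo i dvd int p ^ expo j * M i j"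
proof -
  have add: "f (red p (\<lambda>i. v i + w i)) = red p (\<lambda>i. v' i + w' i)"
    if "f (red p v) = red p v'" "f (red p w) = red p w'" for v w v' w'
    using hom_mult[OF assms(2), of "red p v" "red p w"] that assms(1) by (simp add: red_mult)
  have zero: "f (red p (\<lambda>i. 0)) = red p (\<lambda>i. 0)"
    using hom_one[OF assms(2) group_D group_D] by (simp add: one_D)
  have scale: "f (red p (\<lambda>i. k * w i)) = red p (\<lambda>i. k * w' i)"
    if w: "f (red p w) = red p w'" for k :: int and w w'
  proof (induction k rule: int_induct[where k = 0])
    case base
    then show ?case using zero by simp
  next
    case (step1 k)
    show ?case using add[OF step1(2) w] by (simp add: algebra_simps)
  next
    case (step2 k)
    have "f (red p (\<lambda>i. (k - 1) * w i)) \<in> carrier (grp_D p)"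
      using assms by (auto intro: hom_in_carrier)
    then obtain u where u: "f (red p (\<lambda>i. (k - 1) * w i)) = red p u"
      using assms carrier_D by blast
    have "red p (\<lambda>i. u i + w' i) = red p (\<lambda>i. k * w' i)"
      using add[OF u w] step2(2) by (simp add: algebra_simps)
    then show ?case unfolding u by (simp add: red_eq_iff algebra_simps)
  qed
  have "\<exists>w. f (red p (\<lambda>i. of_bool (i = j))) = red p w" for j :: nat
    using assms carrier_D hom_in_carrier[OF assms(2) red_in_D[OF assms(1)]] by blast
  then obtain N where N: "f (red p (\<lambda>i. of_bool (i = j))) = red p (N j)" for j :: nat
    by metis
  define M where "M i j = N j i" for i j
  have col: "f (red p (\<lambda>i. k * of_bool (i = j))) = red p (\<lambda>i. k * M i j)" for k j
    using scale[OF N] by (simp add: M_def)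
  have "f (red p v) = red p (mat_vec M v)" for v
  proof -
    have "red p v = red p (\<lambda>i. v 1 * of_bool (i = 1) + v 2 * of_bool (i = 2)
        + v 3 * of_bool (i = 3) + v 4 * of_bool (i = 4) + v 5 * of_bool (i = 5))"
      by (simp add: red_eq_coords)
    then show ?thesis
      using add[OF add[OF add[OF add[OF col col] col] col] col]
      unfolding mat_vec_def[abs_def] sum_1_5 by (simp add: mult.commute)
  qed
  moreover have "int p ^ expo i dvd int p ^ expo j * M i j" if "i \<in> {1..5}" "j \<in> {1..5}" for i j
  proof -
    have "red p (\<lambda>i. int p ^ expo j * of_bool (i = j)) = red p (\<lambda>i. 0)"
      unfolding red_eq_iff by auto
    then have "red p (\<lambda>i. int p ^ expo j * M i j) = red p (\<lambda>i. 0)"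
      using col[of "int p ^ expo j" j] zero by simp
    then show ?thesis using that by (auto simp: red_eq_iff)
  qed
  ultimately show ?thesis using that by blast
qed

lemma upper_entry_dvd:
  assumes "0 < p"
    "int p ^ expo i dvd int p ^ expo j * m" "expo j + k = expo i"
  shows "int p ^ k dvd m"
proof -
  have "int p ^ expo j * int p ^ k dvd int p ^ expo j * m"
    using assms by (simp add: power_add[symmetric])
  then show ?thesis using assms by simp
qed

lemma dvd_of_cancel:
  fixes q :: int
  assumes "q \<noteq> 0" "q ^ k * x = q ^ k * (q * y)"
  shows "q dvd x"
  using assms by simp

section \<open>Morphisms between the pairs\<close>

text \<open>
  Here \<open>M\<close> is the matrix of a morphism \<open>f\<close>, and \<open>a\<^sub>i, b\<^sub>i, c\<^sub>i\<close> are the coefficients of \<open>f u\<^sub>i\<close>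
  in terms of the generators of the target subgroup. Every coordinate of these three
  equations, divided by the power of \<open>p\<close> common to its terms, yields a congruence between
  entries of \<open>M\<close> and coefficients; eliminating the coefficients gives the claims.
\<close>

lemma C_morphism_congruences:
  fixes p l m :: nat
  defines "q \<equiv> int p"
  assumes "0 < p"
    and dvd: "\<And>i j. i \<in> {1..5} \<Longrightarrow> j \<in> {1..5} \<Longrightarrow> q ^ expo i dvd q ^ expo j * M i j"
    and u1: "red p (mat_vec M (C_vec p l 1 0 0)) = red p (C_vec p m a1 b1 c1)"
    and u2: "red p (mat_vec M (C_vec p l 0 1 0)) = red p (C_vec p m a2 b2 c2)"
    and u3: "red p (mat_vec M (C_vec p l 0 0 1)) = red p (C_vec p m a3 b3 c3)"
  shows "\<forall>i\<in>{1..5}. q dvd M i i - M 1 1" "q dvd M 1 1 * (int l - int m)"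
proof -
  have q: "q \<noteq> 0" using assms by simp
  note cancel = dvd_of_cancel[OF q]
  have upper: "q ^ k dvd M i j" if "expo j + k = expo i" "i \<in> {1..5}" "j \<in> {1..5}" for i j k
    using upper_entry_dvd[OF \<open>0 < p\<close> dvd[unfolded q_def, OF that(2,3)] that(1)] by (simp add: q_def)
  \<comment> \<open>The cofactors of the entries above the diagonal; \<open>x\<^sub>i\<close> has larger order than \<open>x\<^sub>j\<close> for \<open>i < j\<close>.\<close>
  define r where "r i j = M i j div q ^ (expo i - expo j)" for i j
  have r: "M i j = q ^ (expo i - expo j) * r i j"
    if "expo j \<le> expo i" "i \<in> {1..5}" "j \<in> {1..5}" for i j
    using upper[of j "expo i - expo j" i] that by (simp add: r_def)
  have upper_eqs:
    "M 1 3 = q ^ 3 * r 1 3" "M 1 4 = q ^ 4 * r 1 4" "M 1 5 = q ^ 6 * r 1 5"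
    "M 2 3 = q ^ 2 * r 2 3" "M 2 4 = q ^ 3 * r 2 4" "M 2 5 = q ^ 5 * r 2 5"
    "M 3 4 = q * r 3 4" "M 3 5 = q ^ 3 * r 3 5" "M 4 5 = q ^ 2 * r 4 5"
    using r[of 3 1] r[of 4 1] r[of 5 1] r[of 3 2] r[of 4 2] r[of 5 2] r[of 4 3] r[of 5 3] r[of 5 4]
    by (simp_all add: expo_def)
  have quotients: "\<exists>t. \<forall>i\<in>{1..5}. mat_vec M v i - w i = q ^ expo i * t i"
    if "red p (mat_vec M v) = red p w" for v w
    using that unfolding red_eq_iff dvd_def q_def by (rule bchoice)
  obtain t1 where t1: "\<forall>i\<in>{1..5}. mat_vec M (C_vec p l 1 0 0) i - C_vec p m a1 b1 c1 i = q ^ expo i * t1 i"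
    using quotients[OF u1] by blast
  have col1:
    "q ^ 4 * M 1 1 + q * M 1 4 + M 1 5 - q ^ 4 * a1 = q ^ 7 * t1 1"
    "q ^ 4 * M 2 1 + q * M 2 4 + M 2 5 - q ^ 3 * b1 = q ^ 6 * t1 2"
    "q ^ 4 * M 3 1 + q * M 3 4 + M 3 5 - (q ^ 2 * b1 + q ^ 3 * c1) = q ^ 4 * t1 3"
    "q ^ 4 * M 4 1 + q * M 4 4 + M 4 5 - (q * a1 + q ^ 2 * int m * c1) = q ^ 3 * t1 4"
    "q ^ 4 * M 5 1 + q * M 5 4 + M 5 5 - (a1 + b1) = q * t1 5"
    using t1 unfolding index_cases mat_vec_def sum_1_5
    by (simp_all add: q_def[symmetric] mult.commute)
  obtain t2 where t2: "\<forall>i\<in>{1..5}. mat_vec M (C_vec p l 0 1 0) i - C_vec p m a2 b2 c2 i = q ^ expo i * t2 i"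
    using quotients[OF u2] by blast
  have col2:
    "q ^ 3 * M 2 2 + q ^ 2 * M 2 3 + M 2 5 - q ^ 3 * b2 = q ^ 6 * t2 2"
    "q ^ 3 * M 3 2 + q ^ 2 * M 3 3 + M 3 5 - (q ^ 2 * b2 + q ^ 3 * c2) = q ^ 4 * t2 3"
    "q ^ 3 * M 4 2 + q ^ 2 * M 4 3 + M 4 5 - (q * a2 + q ^ 2 * int m * c2) = q ^ 3 * t2 4"
    "q ^ 3 * M 5 2 + q ^ 2 * M 5 3 + M 5 5 - (a2 + b2) = q * t2 5"
    using t2 unfolding index_cases mat_vec_def sum_1_5
    by (simp_all add: q_def[symmetric] mult.commute)
  obtain t3 where t3: "\<forall>i\<in>{1..5}. mat_vec M (C_vec p l 0 0 1) i - C_vec p m a3 b3 c3 i = q ^ expo i * t3 i"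
    using quotients[OF u3] by blast
  have col3:
    "q ^ 3 * M 1 3 + q ^ 2 * int l * M 1 4 - q ^ 4 * a3 = q ^ 7 * t3 1"
    "q ^ 3 * M 2 3 + q ^ 2 * int l * M 2 4 - q ^ 3 * b3 = q ^ 6 * t3 2"
    "q ^ 3 * M 3 3 + q ^ 2 * int l * M 3 4 - (q ^ 2 * b3 + q ^ 3 * c3) = q ^ 4 * t3 3"
    "q ^ 3 * M 4 3 + q ^ 2 * int l * M 4 4 - (q * a3 + q ^ 2 * int m * c3) = q ^ 3 * t3 4"
    using t3 unfolding index_cases mat_vec_def sum_1_5
    by (simp_all add: q_def[symmetric] mult.commute)
  note expand = algebra_simps eval_nat_numeral
  note cols = col1[unfolded upper_eqs] col2[unfolded upper_eqs] col3[unfolded upper_eqs]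
  \<comment> \<open>The five coordinates of \<open>f u\<^sub>1\<close>. The third one shows that \<open>M\<^sub>3\<^sub>4\<close> is divisible even by \<open>p\<^sup>2\<close>,
    which keeps it out of the third coordinate of \<open>f u\<^sub>3\<close>.\<close>
  have M11: "q dvd M 1 1 - a1"
    by (rule cancel[of 4 _ "q\<^sup>2 * t1 1 - r 1 4 - q * r 1 5"])
       (use cols(1) in \<open>simp add: expand\<close>)
  have "q dvd b1"
    by (rule cancel[of 3 _ "M 2 1 + r 2 4 + q * r 2 5 - q\<^sup>2 * t1 2"])
       (use cols(2) in \<open>simp add: expand\<close>)
  then obtain b1' where b1: "b1 = q * b1'" by blast
  have "q dvd r 3 4"
    by (rule cancel[of 2 _ "q * t1 3 - q * M 3 1 - r 3 5 + b1' + c1"])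
       (use cols(3)[unfolded b1] in \<open>simp add: expand\<close>)
  then obtain r34 where r34: "r 3 4 = q * r34" by blast
  have M44: "q dvd M 4 4 - a1"
    by (rule cancel[of 1 _ "q * t1 4 - q\<^sup>2 * M 4 1 - r 4 5 + int m * c1"])
       (use cols(4) in \<open>simp add: expand\<close>)
  have M55: "q dvd M 5 5 - a1"
    by (rule cancel[of 0 _ "t1 5 - q ^ 3 * M 5 1 - M 5 4 + b1'"])
       (use cols(5)[unfolded b1] in \<open>simp add: expand\<close>)
  \<comment> \<open>The coordinates 2 to 5 of \<open>f u\<^sub>2\<close>.\<close>
  have M22: "q dvd M 2 2 - b2"
    by (rule cancel[of 3 _ "q\<^sup>2 * t2 2 - r 2 3 - q * r 2 5"])
       (use cols(6) in \<open>simp add: expand\<close>)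
  have M33: "q dvd M 3 3 - b2"
    by (rule cancel[of 2 _ "q * t2 3 - M 3 2 - r 3 5 + c2"])
       (use cols(7) in \<open>simp add: expand\<close>)
  have "q dvd a2"
    by (rule cancel[of 1 _ "q * M 4 2 + M 4 3 + r 4 5 - int m * c2 - q * t2 4"])
       (use cols(8) in \<open>simp add: expand\<close>)
  then obtain a2' where a2: "a2 = q * a2'" by blast
  have M55': "q dvd M 5 5 - b2"
    by (rule cancel[of 0 _ "t2 5 - q\<^sup>2 * M 5 2 - q * M 5 3 + a2'"])
       (use cols(9)[unfolded a2] in \<open>simp add: expand\<close>)
  \<comment> \<open>The coordinates 1 to 4 of \<open>f u\<^sub>3\<close>. The first three show that \<open>f u\<^sub>3\<close> is \<open>M\<^sub>3\<^sub>3 u\<^sub>3\<close>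
    up to \<open>p\<close> times the target subgroup; the fourth then compares the two parameters.\<close>
  have "q ^ 4 * a3 = q ^ 4 * (q\<^sup>2 * (r 1 3 + int l * r 1 4 - q * t3 1))"
    using cols(10) by (simp add: expand)
  then obtain a3' where a3: "a3 = q\<^sup>2 * a3'"
    unfolding mult_cancel_left using q by auto
  have "q ^ 3 * b3 = q ^ 3 * (q\<^sup>2 * (r 2 3 + int l * r 2 4 - q * t3 2))"
    using cols(11) by (simp add: expand)
  then obtain b3' where b3: "b3 = q\<^sup>2 * b3'"
    unfolding mult_cancel_left using q by auto
  have c3: "q dvd M 3 3 - c3"
    by (rule cancel[of 3 _ "t3 3 - int l * r34 + b3'"])
       (use cols(12)[unfolded b3 r34] in \<open>simp add: expand\<close>)
  have twist: "q dvd int l * M 4 4 - int m * c3"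
    by (rule cancel[of 2 _ "t3 4 - M 4 3 + a3'"])
       (use cols(13)[unfolded a3] in \<open>simp add: expand\<close>)
  have diag: "q dvd M 1 1 - M 1 1" "q dvd M 4 4 - M 1 1" "q dvd M 5 5 - M 1 1"
    "q dvd M 2 2 - M 1 1" "q dvd M 3 3 - M 1 1"
    using dvd_diff[OF M44 M11] dvd_diff[OF M55 M11]
      dvd_add[OF dvd_diff[OF M22 M55'] dvd_diff[OF M55 M11]]
      dvd_add[OF dvd_diff[OF M33 M55'] dvd_diff[OF M55 M11]] by simp_all
  then show "\<forall>i\<in>{1..5}. q dvd M i i - M 1 1" unfolding index_cases by blast
  have "M 1 1 * (int l - int m)
      = (int l * M 4 4 - int m * c3) - int l * (M 4 4 - M 1 1) - int m * (M 3 3 - c3)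
        + int m * (M 3 3 - M 1 1)"
    by (simp add: algebra_simps)
  then show "q dvd M 1 1 * (int l - int m)"
    using twist c3 diag by (metis dvd_add dvd_diff dvd_mult)
qed

text \<open>
  Above the diagonal only the divisibility by \<open>p\<close> is retained: this is all that
  is needed to compute with diagonals modulo \<open>p\<close>.
\<close>

definition represents :: "nat \<Rightarrow> (nat \<Rightarrow> nat \<Rightarrow> int) \<Rightarrow> (elem5 \<Rightarrow> elem5) \<Rightarrow> bool" where
  "represents p M f \<longleftrightarrow> (\<forall>v. f (red p v) = red p (mat_vec M v)) \<and>
     (\<forall>i\<in>{1..5}. \<forall>j\<in>{1..5}. i < j \<longrightarrow> int p dvd M i j)"

lemma C_morphism_matrix:
  assumes "1 < p" "f \<in> S_mor (sub_C p l) (grp_D p) (sub_C p m) (grp_D p)"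
  obtains M where "represents p M f" "\<forall>i\<in>{1..5}. int p dvd M i i - M 1 1"
    "int p dvd M 1 1 * (int l - int m)"
proof -
  have f: "f \<in> hom (grp_D p) (grp_D p)" "\<And>x. x \<in> sub_C p l \<Longrightarrow> f x \<in> sub_C p m"
    using assms(2) by (auto simp: S_mor_def)
  have "0 < p" using assms by simp
  obtain M where M: "\<And>v. f (red p v) = red p (mat_vec M v)"
    and dvd: "\<And>i j. i \<in> {1..5} \<Longrightarrow> j \<in> {1..5} \<Longrightarrow> int p ^ expo i dvd int p ^ expo j * M i j"
    using hom_imp_matrix[OF \<open>0 < p\<close> f(1)] by metis
  have image: "\<exists>a b c. red p (mat_vec M v) = red p (C_vec p m a b c)" if "red p v \<in> sub_C p l" for v
    using f(2)[OF that] sub_C_subset[OF assms(1), of m] unfolding M by blast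
  obtain a1 b1 c1 a2 b2 c2 a3 b3 c3 where
    "red p (mat_vec M (C_vec p l 1 0 0)) = red p (C_vec p m a1 b1 c1)"
    "red p (mat_vec M (C_vec p l 0 1 0)) = red p (C_vec p m a2 b2 c2)"
    "red p (mat_vec M (C_vec p l 0 0 1)) = red p (C_vec p m a3 b3 c3)"
    using generators_in_C[OF assms(1), THEN image] by metis
  note cong = C_morphism_congruences[OF \<open>0 < p\<close> dvd this]
  have "int p dvd M i j" if ij: "i \<in> {1..5}" "j \<in> {1..5}" "i < j" for i j
  proof -
    have "\<forall>i\<in>{1..5}. \<forall>j\<in>{1..5}. i < j \<longrightarrow> expo j < expo i"
      unfolding index_cases by (simp add: expo_def)
    then have "expo j < expo i" using ij by blast
    then have "int p ^ (expo i - expo j) dvd M i j" "int p dvd int p ^ (expo i - expo j)"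
      using upper_entry_dvd[OF \<open>0 < p\<close> dvd[OF ij(1,2)]] by (auto intro!: dvd_power)
    then show ?thesis using dvd_trans by blast
  qed
  with M have "represents p M f" by (auto simp: represents_def)
  then show ?thesis using cong that by blast
qed

lemma red_eq_mod_p:
  assumes "red p v = red p w" "i \<in> {1..5}"
  shows "int p dvd v i - w i"
proof -
  have "\<forall>i\<in>{1..5}. 0 < expo i" unfolding index_cases by (simp add: expo_def)
  then have "int p dvd int p ^ expo i" using assms(2) by (intro dvd_power) auto
  moreover have "int p ^ expo i dvd v i - w i" using assms by (simp add: red_eq_iff)
  ultimately show ?thesis using dvd_trans by blast
qed

text \<open>
  Modulo \<open>p\<close> the first row of \<open>M\<close> vanishes off the diagonal. Since the diagonal of a morphism
  is constant modulo \<open>p\<close>, following the first coordinate is enough to determine it for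
  composites and sums.
\<close>

lemma first_coordinate_mod_p:
  assumes "represents p M f"
  shows "int p dvd mat_vec M v 1 - M 1 1 * v 1"
  using assms unfolding represents_def index_cases mat_vec_def sum_1_5 by simp

lemma mat_vec_unit: "mat_vec M (\<lambda>i. of_bool (i = 1)) i = M i 1"
  by (simp add: mat_vec_def sum_1_5)

section \<open>Indecomposability\<close>

text \<open>
  Modulo \<open>p\<close> the matrix is strictly lower triangular. An element \<open>u\<close> of the image is fixed by
  \<open>e\<close>, so each of its coordinates is, modulo \<open>p\<close>, a combination of the preceding ones, and
  all of them vanish. Thus \<open>e D \<subseteq> p D\<close>; applying \<open>e = e\<^sup>2\<close> repeatedly gives
  \<open>e D \<subseteq> p\<^sup>k D\<close> for all \<open>k\<close>, and \<open>p\<^sup>7 D = 0\<close>.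
\<close>

lemma nilpotent_idempotent_trivial:
  assumes "0 < p" and M: "represents p M e" "\<forall>i\<in>{1..5}. int p dvd M i i"
    and idem: "\<And>x. x \<in> carrier (grp_D p) \<Longrightarrow> e (e x) = e x"
    and "x \<in> carrier (grp_D p)"
  shows "e x = \<one>\<^bsub>grp_D p\<^esub>"
proof -
  have e: "e (red p v) = red p (mat_vec M v)" for v
    using M(1) by (simp add: represents_def)
  have into_pD: "\<exists>w. e (red p v) = red p (\<lambda>i. int p * w i)" for v
  proof -
    define u where "u = mat_vec M v"
    have fixed: "red p (mat_vec M u) = red p u"
      using idem[OF red_in_D[OF \<open>0 < p\<close>]] unfolding e u_def .
    have step: "int p dvd u i" if "i \<in> {1..5}" "int p dvd mat_vec M u i" for i
      using dvd_diff[OF that(2) red_eq_mod_p[OF fixed that(1)]] by simp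
    have Mij: "\<forall>i\<in>{1..5}. \<forall>j\<in>{1..5}. i \<le> j \<longrightarrow> int p dvd M i j"
      using M unfolding represents_def by (auto simp: order_le_less)
    note M_dvd = Mij[unfolded index_cases] mat_vec_def[of M u, unfolded sum_1_5]
    have "int p dvd u 1"
      by (rule step) (use M_dvd in simp_all)
    moreover from this have "int p dvd u 2"
      by (intro step) (use M_dvd in simp_all)
    moreover from calculation have "int p dvd u 3"
      by (intro step) (use M_dvd in simp_all)
    moreover from calculation have "int p dvd u 4"
      by (intro step) (use M_dvd in simp_all)
    moreover from calculation have "int p dvd u 5"
      by (intro step) (use M_dvd in simp_all)
    ultimately have "red p u = red p (\<lambda>i. int p * (u i div int p))"
      by (simp add: red_eq_coords)
    then show ?thesis unfolding e u_def[symmetric] by (rule exI[of _ "\<lambda>i. u i div int p"])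
  qed
  obtain v where x: "x = red p v" using assms(1,5) carrier_D by blast
  have "\<exists>w. e (red p v) = red p (\<lambda>i. int p ^ k * w i)" for k
  proof (induction k)
    case 0
    then show ?case unfolding e by auto
  next
    case (Suc k)
    then obtain w where w: "e (red p v) = red p (\<lambda>i. int p ^ k * w i)" by blast
    obtain w' where w': "red p (mat_vec M w) = red p (\<lambda>i. int p * w' i)"
      using into_pD unfolding e by blast
    have "e (red p v) = e (red p (\<lambda>i. int p ^ k * w i))"
      using idem[OF red_in_D[OF \<open>0 < p\<close>], of v] w by simp
    also have "\<dots> = red p (\<lambda>i. int (p ^ k) * mat_vec M w i)"
      unfolding e by (simp add: mat_vec_def[abs_def] sum_distrib_left mult.left_commute)
    also have "\<dots> = red p (\<lambda>i. int (p ^ k) * (int p * w' i))"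
      unfolding red_pow[symmetric] w' ..
    finally have "e (red p v) = red p (\<lambda>i. int p ^ Suc k * w' i)"
      by (simp add: mult_ac)
    then show ?case by (rule exI[of _ w'])
  qed
  from this[of 7] obtain w where "e x = red p (\<lambda>i. int p ^ 7 * w i)"
    unfolding x by (rule exE)
  then show ?thesis by (simp add: one_D red_eq_coords le_imp_power_dvd)
qed

text \<open>
  The first diagonal entries of \<open>e\<close> and \<open>e'\<close> are idempotent modulo \<open>p\<close> and add up to \<open>1\<close>, so
  one of them is divisible by the prime \<open>p\<close>, and then so is the whole diagonal.
\<close>

lemma complementary_idempotents_trivial:
  assumes p: "Factorial_Ring.prime p"
    and e: "e \<in> S_mor (sub_C p l) (grp_D p) (sub_C p l) (grp_D p)"
    and e': "e' \<in> S_mor (sub_C p l) (grp_D p) (sub_C p l) (grp_D p)"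
    and idem: "\<And>x. x \<in> carrier (grp_D p) \<Longrightarrow> e (e x) = e x"
    and idem': "\<And>x. x \<in> carrier (grp_D p) \<Longrightarrow> e' (e' x) = e' x"
    and sum: "\<And>x. x \<in> carrier (grp_D p) \<Longrightarrow> e x \<otimes>\<^bsub>grp_D p\<^esub> e' x = x"
  shows "(\<forall>x\<in>carrier (grp_D p). e x = \<one>\<^bsub>grp_D p\<^esub>) \<or> (\<forall>x\<in>carrier (grp_D p). e' x = \<one>\<^bsub>grp_D p\<^esub>)"
proof -
  have "1 < p" using p by (rule prime_gt_1_nat)
  then have "0 < p" by simp
  obtain M where M: "represents p M e" "\<forall>i\<in>{1..5}. int p dvd M i i - M 1 1"
    using C_morphism_matrix[OF \<open>1 < p\<close> e] by metis
  obtain N where N: "represents p N e'" "\<forall>i\<in>{1..5}. int p dvd N i i - N 1 1"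
    using C_morphism_matrix[OF \<open>1 < p\<close> e'] by metis
  have eM: "e (red p v) = red p (mat_vec M v)" and eN: "e' (red p v) = red p (mat_vec N v)" for v
    using M(1) N(1) by (simp_all add: represents_def)
  define v where "v = (\<lambda>i. of_bool (i = (1::nat)) :: int)"
  have v: "mat_vec M v 1 = M 1 1" "mat_vec N v 1 = N 1 1" "v 1 = 1"
    by (simp_all only: v_def mat_vec_unit) simp
  have "red p (mat_vec M (mat_vec M v)) = red p (mat_vec M v)"
    using idem[OF red_in_D[OF \<open>0 < p\<close>]] unfolding eM .
  from red_eq_mod_p[OF this, of 1] have "int p dvd mat_vec M (mat_vec M v) 1 - M 1 1"
    using v by simp
  from dvd_diff[OF this first_coordinate_mod_p[OF M(1), of "mat_vec M v", unfolded v(1)]]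
  have "int p dvd M 1 1 * (M 1 1 - 1)"
    by (simp add: algebra_simps)
  moreover have "Factorial_Ring.prime (int p)" using p by simp
  ultimately have cases: "int p dvd M 1 1 \<or> int p dvd M 1 1 - 1"
    using prime_dvd_mult_iff by blast
  have "red p (\<lambda>i. mat_vec M v i + mat_vec N v i) = red p v"
    using sum[OF red_in_D[OF \<open>0 < p\<close>]] unfolding eM eN red_mult .
  from red_eq_mod_p[OF this, of 1] have trace: "int p dvd M 1 1 + N 1 1 - 1"
    using v by simp
  show ?thesis
  proof (cases "int p dvd M 1 1")
    case True
    then have "int p dvd M i i" if "i \<in> {1..5}" for i
      using dvd_add[OF bspec[OF M(2) that]] by fastforce
    then have "\<forall>i\<in>{1..5}. int p dvd M i i" by blast
    then show ?thesis
      using nilpotent_idempotent_trivial[OF \<open>0 < p\<close> M(1) _ idem] by simp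
  next
    case False
    then have "int p dvd M 1 1 - 1" using cases by blast
    from dvd_diff[OF trace this] have "int p dvd N 1 1" by simp
    then have "int p dvd N i i" if "i \<in> {1..5}" for i
      using dvd_add[OF bspec[OF N(2) that]] by fastforce
    then have "\<forall>i\<in>{1..5}. int p dvd N i i" by blast
    then show ?thesis
      using nilpotent_idempotent_trivial[OF \<open>0 < p\<close> N(1) _ idem'] by simp
  qed
qed

text \<open>
  A decomposition of the pair yields the idempotents that project onto its summands; they
  respect the subgroup because it decomposes along with the group.
\<close>

lemma C_indecomposable:
  assumes p: "Factorial_Ring.prime p"
  shows "S_indecomposable TYPE('b) TYPE('c) p 3 7 (sub_C p l) (grp_D p)"
  unfolding S_indecomposable_def
proof (intro conjI allI impI)
  have "1 < p" using p by (rule prime_gt_1_nat)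
  then have "0 < p" by simp
  show "S_obj p 3 7 (sub_C p l) (grp_D p)" by (rule S_obj_C[OF \<open>1 < p\<close>])
  have "red p (\<lambda>i. 1) \<noteq> \<one>\<^bsub>grp_D p\<^esub>"
    using \<open>1 < p\<close> by (simp add: red_def grp_D_def)
  then show "\<not> trivial_group (grp_D p)"
    using red_in_D[OF \<open>0 < p\<close>] unfolding trivial_group_def by blast
  fix A1 :: "'b set" and B1 and A2 :: "'c set" and B2
  assume obj1: "S_obj p 3 7 A1 B1" and obj2: "S_obj p 3 7 A2 B2"
    and iso: "S_isomorphic (sub_C p l) (grp_D p) (A1 \<times> A2) (B1 \<times>\<times> B2)"
  obtain f g where f: "f \<in> hom (grp_D p) (B1 \<times>\<times> B2)" "f ` sub_C p l \<subseteq> A1 \<times> A2"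
    and g: "g \<in> hom (B1 \<times>\<times> B2) (grp_D p)" "g ` (A1 \<times> A2) \<subseteq> sub_C p l"
    and gf: "\<And>x. x \<in> carrier (grp_D p) \<Longrightarrow> g (f x) = x"
    and fg: "\<And>y. y \<in> carrier (B1 \<times>\<times> B2) \<Longrightarrow> f (g y) = y"
    using iso by (auto simp: S_isomorphic_def S_mor_def)
  interpret B1: comm_group B1 using obj1 by (simp add: S_obj_def)
  interpret B2: comm_group B2 using obj2 by (simp add: S_obj_def)
  have oneA: "\<one>\<^bsub>B1\<^esub> \<in> A1" "\<one>\<^bsub>B2\<^esub> \<in> A2"
    using obj1 obj2 by (auto simp: S_obj_def subgroup.one_closed)
  have fin: "fst (f x) \<in> carrier B1" "snd (f x) \<in> carrier B2" if "x \<in> carrier (grp_D p)" for x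
    using hom_in_carrier[OF f(1) that] by (auto simp: DirProd_def)
  have fmult: "fst (f (x \<otimes>\<^bsub>grp_D p\<^esub> y)) = fst (f x) \<otimes>\<^bsub>B1\<^esub> fst (f y)"
    "snd (f (x \<otimes>\<^bsub>grp_D p\<^esub> y)) = snd (f x) \<otimes>\<^bsub>B2\<^esub> snd (f y)"
    if "x \<in> carrier (grp_D p)" "y \<in> carrier (grp_D p)" for x y
    using hom_mult[OF f(1) that] by (simp_all add: mult_DirProd')
  have gmult: "g (a, b) \<otimes>\<^bsub>grp_D p\<^esub> g (a', b') = g (a \<otimes>\<^bsub>B1\<^esub> a', b \<otimes>\<^bsub>B2\<^esub> b')"
    if "a \<in> carrier B1" "b \<in> carrier B2" "a' \<in> carrier B1" "b' \<in> carrier B2" for a b a' b'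
    using hom_mult[OF g(1), of "(a, b)" "(a', b')"] that by simp
  have gin: "g (a, b) \<in> carrier (grp_D p)" if "a \<in> carrier B1" "b \<in> carrier B2" for a b
    using hom_in_carrier[OF g(1), of "(a, b)"] that by simp
  have fg': "f (g (a, b)) = (a, b)" if "a \<in> carrier B1" "b \<in> carrier B2" for a b
    using fg[of "(a, b)"] that by simp
  have f_one: "f \<one>\<^bsub>grp_D p\<^esub> = (\<one>\<^bsub>B1\<^esub>, \<one>\<^bsub>B2\<^esub>)"
    using hom_one[OF f(1) group_D DirProd_group[OF B1.is_group B2.is_group]] by simp
  \<comment> \<open>The projections of \<open>B1 \<times>\<times> B2\<close> onto its factors, transported to \<open>D\<close>.\<close>
  define e where "e x = g (fst (f x), \<one>\<^bsub>B2\<^esub>)" for x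
  define e' where "e' x = g (\<one>\<^bsub>B1\<^esub>, snd (f x))" for x
  have "e \<in> hom (grp_D p) (grp_D p)" "e' \<in> hom (grp_D p) (grp_D p)"
    by (auto simp: e_def e'_def hom_def gin fin fmult gmult)
  moreover have "e x \<in> sub_C p l" "e' x \<in> sub_C p l" if "x \<in> sub_C p l" for x
  proof -
    have "fst (f x) \<in> A1" "snd (f x) \<in> A2" using f(2) that by force+
    then show "e x \<in> sub_C p l" "e' x \<in> sub_C p l"
      using g(2) oneA by (auto simp: e_def e'_def)
  qed
  ultimately have mor: "e \<in> S_mor (sub_C p l) (grp_D p) (sub_C p l) (grp_D p)"
    "e' \<in> S_mor (sub_C p l) (grp_D p) (sub_C p l) (grp_D p)"
    by (auto simp: S_mor_def)
  have idem: "e (e x) = e x" "e' (e' x) = e' x" if "x \<in> carrier (grp_D p)" for x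
    using that by (simp_all add: e_def e'_def fg' fin)
  have sum: "e x \<otimes>\<^bsub>grp_D p\<^esub> e' x = x" if "x \<in> carrier (grp_D p)" for x
    using that by (simp add: e_def e'_def gmult fin gf)
  from complementary_idempotents_trivial[OF p mor idem sum]
  show "trivial_group B1 \<or> trivial_group B2"
  proof
    assume triv: "\<forall>x\<in>carrier (grp_D p). e x = \<one>\<^bsub>grp_D p\<^esub>"
    have "b = \<one>\<^bsub>B1\<^esub>" if b: "b \<in> carrier B1" for b
    proof -
      have "g (b, \<one>\<^bsub>B2\<^esub>) = \<one>\<^bsub>grp_D p\<^esub>"
        using bspec[OF triv gin[OF b B2.one_closed]] b by (simp add: e_def fg')
      then show ?thesis using fg'[OF b B2.one_closed] f_one by simp
    qed
    then show ?thesis using B1.is_group by (auto simp: trivial_group_def)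
  next
    assume triv: "\<forall>x\<in>carrier (grp_D p). e' x = \<one>\<^bsub>grp_D p\<^esub>"
    have "b = \<one>\<^bsub>B2\<^esub>" if b: "b \<in> carrier B2" for b
    proof -
      have "g (\<one>\<^bsub>B1\<^esub>, b) = \<one>\<^bsub>grp_D p\<^esub>"
        using bspec[OF triv gin[OF B1.one_closed b]] b by (simp add: e'_def fg')
      then show ?thesis using fg'[OF B1.one_closed b] f_one by simp
    qed
    then show ?thesis using B2.is_group by (auto simp: trivial_group_def)
  qed
qed

section \<open>Isomorphism classes\<close>

text \<open>
  The diagonals of an isomorphism and of its inverse are inverse to each other modulo \<open>p\<close>, so
  the factor \<open>M\<^sub>1\<^sub>1\<close> in \<open>p dvd M\<^sub>1\<^sub>1 (l - m)\<close> can be cancelled.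
\<close>

lemma C_isomorphic_imp_cong:
  assumes p: "Factorial_Ring.prime p"
    and iso: "S_isomorphic (sub_C p l) (grp_D p) (sub_C p m) (grp_D p)"
  shows "int p dvd int l - int m"
proof -
  have "1 < p" using p by (rule prime_gt_1_nat)
  then have "0 < p" by simp
  obtain f g where f: "f \<in> S_mor (sub_C p l) (grp_D p) (sub_C p m) (grp_D p)"
    and g: "g \<in> S_mor (sub_C p m) (grp_D p) (sub_C p l) (grp_D p)"
    and gf: "\<And>x. x \<in> carrier (grp_D p) \<Longrightarrow> g (f x) = x"
    using iso by (auto simp: S_isomorphic_def)
  obtain M where M: "represents p M f" "int p dvd M 1 1 * (int l - int m)"
    using C_morphism_matrix[OF \<open>1 < p\<close> f] by metis
  obtain N where N: "represents p N g"
    using C_morphism_matrix[OF \<open>1 < p\<close> g] by metis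
  have fM: "f (red p v) = red p (mat_vec M v)" and gN: "g (red p v) = red p (mat_vec N v)" for v
    using M(1) N(1) by (simp_all add: represents_def)
  define v where "v = (\<lambda>i. of_bool (i = (1::nat)) :: int)"
  have v: "mat_vec M v 1 = M 1 1" "v 1 = 1"
    by (simp_all only: v_def mat_vec_unit) simp
  have "red p (mat_vec N (mat_vec M v)) = red p v"
    using gf[OF red_in_D[OF \<open>0 < p\<close>]] unfolding fM gN .
  from red_eq_mod_p[OF this, of 1] have "int p dvd mat_vec N (mat_vec M v) 1 - 1"
    using v by simp
  from dvd_diff[OF this first_coordinate_mod_p[OF N, of "mat_vec M v", unfolded v(1)]]
  have unit: "int p dvd N 1 1 * M 1 1 - 1"
    by simp
  have "\<not> int p dvd M 1 1"
  proof
    assume "int p dvd M 1 1"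
    then have "int p dvd N 1 1 * M 1 1" by simp
    from dvd_diff[OF this unit] show False using \<open>1 < p\<close> by simp
  qed
  moreover have "Factorial_Ring.prime (int p)" using p by simp
  ultimately show ?thesis using M(2) prime_dvd_mult_iff by blast
qed

theorem corollary15:
  fixes p :: nat
  assumes "Factorial_Ring.prime p"
  shows "(\<forall>l\<in>{0..p - 1}. S_obj p 3 7 (sub_C p l) (grp_D p)) \<and>
         (\<forall>l\<in>{0..p - 1}.
            S_indecomposable TYPE('b) TYPE('c) p 3 7 (sub_C p l) (grp_D p)) \<and>
         (\<forall>l\<in>{0..p - 1}. \<forall>l'\<in>{0..p - 1}. l \<noteq> l' \<longrightarrow>
            \<not> S_isomorphic (sub_C p l) (grp_D p) (sub_C p l') (grp_D p))"
proof -
  have "1 < p" using assms by (rule prime_gt_1_nat)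
  have "l = l'" if "l \<in> {0..p - 1}" "l' \<in> {0..p - 1}"
    "S_isomorphic (sub_C p l) (grp_D p) (sub_C p l') (grp_D p)" for l l'
  proof -
    have "\<bar>int l - int l'\<bar> < int p" using that \<open>1 < p\<close> by auto
    moreover have "int p dvd int l - int l'"
      by (rule C_isomorphic_imp_cong[OF assms that(3)])
    ultimately show ?thesis using dvd_imp_le_int[of "int l - int l'" "int p"] by linarith
  qed
  then show ?thesis
    using S_obj_C[OF \<open>1 < p\<close>] C_indecomposable[OF assms] by blast
qed

end
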